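(* Let $(B,+,\circ)$ be a Hausdorff topological skew left brace. Then $\mathrm{FCI}(B)$ is a Borel subset of $B$.
   Context: A skew left brace is a set $B$ with two group structures $(B,+)$ and $(B,\circ)$ (neither assumed abelian) such that $a\circ(b+c)=(a\circ b)-a+(a\circ c)$ for all $a,b,c\in B$, where $-a$ is the inverse of $a$ in $(B,+)$. The identities of the two groups coincide and are denoted by $1$. A topological skew left brace is a skew left brace equipped with one topology for which both $(B,+)$ and $(B,\circ)$ are topological groups; it is Hausdorff if this topology is. Put $a*b:=-a+(a\circ b)-b$ and $[a,b]^+:=a+b-a-b$. The brace centralizer of $x\in B$ is $\mathrm{Cb}_B(x):=\{b\in B\mid x*b=b*x=[x,b]^+=1\}$; it is a subgroup of $(B,\circ)$. $\mathrm{FCI}(B)$ is the set of all $x\in B$ such that the index $[(B,\circ):\mathrm{Cb}_B(x)]$ is finite. *)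

theory Defs
  imports "HOL-Analysis.Abstract_Topological_Spaces" "HOL-Analysis.Sigma_Algebra"
    "HOL-Algebra.Ring" "HOL-Algebra.Coset"
begin

(* A skew brace is carried by a ring record: \<oplus> is the (not necessarily abelian) additive
   operation and \<otimes> is the circle operation.  The operations \<ominus> of the library are defined for
   arbitrary records, as inverses in "add_monoid B", so they do not presuppose commutativity. *)

locale skew_left_brace =
  fixes B :: "('a, 'm) ring_scheme" (structure)
  assumes add_group: "group (add_monoid B)"
    and circ_group: "group B"
    and brace_law: "\<lbrakk>a \<in> carrier B; b \<in> carrier B; c \<in> carrier B\<rbrakk>
      \<Longrightarrow> a \<otimes> (b \<oplus> c) = (a \<otimes> b) \<ominus> a \<oplus> (a \<otimes> c)"

definition topological_group :: "('a, 'm) monoid_scheme \<Rightarrow> 'a topology \<Rightarrow> bool" where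
  "topological_group G T \<longleftrightarrow> group G \<and> topspace T = carrier G
     \<and> continuous_map (prod_topology T T) T (\<lambda>(x, y). x \<otimes>\<^bsub>G\<^esub> y)
     \<and> continuous_map T T (m_inv G)"

locale topological_skew_left_brace = skew_left_brace B
  for B :: "('a, 'm) ring_scheme" (structure) +
  fixes T :: "'a topology"
  assumes add_topological_group: "topological_group (add_monoid B) T"
    and circ_topological_group: "topological_group B T"

locale Hausdorff_topological_skew_left_brace = topological_skew_left_brace +
  assumes Hausdorff: "Hausdorff_space T"

definition brace_star :: "('a, 'm) ring_scheme \<Rightarrow> 'a \<Rightarrow> 'a \<Rightarrow> 'a" where
  "brace_star B a b = \<ominus>\<^bsub>B\<^esub> a \<oplus>\<^bsub>B\<^esub> (a \<otimes>\<^bsub>B\<^esub> b) \<ominus>\<^bsub>B\<^esub> b"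

definition add_commutator :: "('a, 'm) ring_scheme \<Rightarrow> 'a \<Rightarrow> 'a \<Rightarrow> 'a" where
  "add_commutator B a b = a \<oplus>\<^bsub>B\<^esub> b \<ominus>\<^bsub>B\<^esub> a \<ominus>\<^bsub>B\<^esub> b"

definition brace_centralizer :: "('a, 'm) ring_scheme \<Rightarrow> 'a \<Rightarrow> 'a set" where
  "brace_centralizer B x =
     {b \<in> carrier B. brace_star B x b = \<one>\<^bsub>B\<^esub> \<and> brace_star B b x = \<one>\<^bsub>B\<^esub>
        \<and> add_commutator B x b = \<one>\<^bsub>B\<^esub>}"

(* The index is the number of right cosets with respect to the circle operation; it is
   finite iff the number of left cosets is. *)
definition FCI :: "('a, 'm) ring_scheme \<Rightarrow> 'a set" where
  "FCI B = {x \<in> carrier B. finite (rcosets\<^bsub>B\<^esub> (brace_centralizer B x))}"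

(* The library's "borel" refers to the topology of a type class, hence this version for
   a topology given as an object. *)
definition borel_sets_of :: "'a topology \<Rightarrow> 'a set set" where
  "borel_sets_of T = sigma_sets (topspace T) {U. openin T U}"

context skew_left_brace
begin

lemma zero_eq_one: "\<zero> = \<one>"
proof -
  interpret A: group "add_monoid B" by (rule add_group)
  interpret C: group B by (rule circ_group)
  have z: "\<zero> \<in> carrier B" using A.one_closed by simp
  have zz: "\<zero> \<oplus> \<zero> = \<zero>" using A.l_one[of \<zero>] z by simp
  have "\<one> \<otimes> (\<zero> \<oplus> \<zero>) = (\<one> \<otimes> \<zero>) \<ominus> \<one> \<oplus> (\<one> \<otimes> \<zero>)" using brace_law z by simp
  hence "\<zero> = \<zero> \<ominus> \<one> \<oplus> \<zero>" using z zz by simp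
  hence "\<zero> = \<ominus> \<one>"
    using A.l_one[of "\<ominus> \<one>"] A.r_one[of "\<ominus> \<one>"] A.inv_closed[of \<one>]
    by (simp add: a_minus_def a_inv_def)
  thus ?thesis using A.inv_inv[of \<one>] A.inv_one by (simp add: a_inv_def)
qed

lemma brace_centralizer_iff:
  assumes x: "x \<in> carrier B"
  shows "b \<in> brace_centralizer B x \<longleftrightarrow>
    b \<in> carrier B \<and> x \<otimes> b = x \<oplus> b \<and> b \<otimes> x = b \<oplus> x \<and> x \<oplus> b = b \<oplus> x"
proof -
  interpret A: group "add_monoid B" by (rule add_group)
  interpret C: group B by (rule circ_group)
  have star: "brace_star B p q = \<one> \<longleftrightarrow> p \<otimes> q = p \<oplus> q"
    if "p \<in> carrier B" "q \<in> carrier B" for p q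
  proof -
    have pq: "p \<otimes> q \<in> carrier B" using that by simp
    have "brace_star B p q = \<zero> \<longleftrightarrow> \<ominus> p \<oplus> (p \<otimes> q) = q"
      using A.inv_solve_right'[of \<zero> "\<ominus> p \<oplus> (p \<otimes> q)" q] A.inv_closed[of p] A.l_one[of q]
        A.m_closed[of "\<ominus> p" "p \<otimes> q"] A.one_closed that pq
      by (auto simp: brace_star_def a_minus_def a_inv_def)
    also have "\<dots> \<longleftrightarrow> p \<otimes> q = p \<oplus> q"
      using A.inv_solve_left'[of q p "p \<otimes> q"] that pq by (auto simp: a_inv_def)
    finally show ?thesis by (simp add: zero_eq_one)
  qed
  have comm: "add_commutator B x b = \<one> \<longleftrightarrow> x \<oplus> b = b \<oplus> x" if b: "b \<in> carrier B"
  proof -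
    have c: "x \<oplus> b \<in> carrier B" using A.m_closed[of x b] x b by simp
    have d: "x \<oplus> b \<ominus> x \<in> carrier B"
      using A.m_closed[of "x \<oplus> b" "\<ominus> x"] A.inv_closed[of x] x c
      by (simp add: a_minus_def a_inv_def)
    have "add_commutator B x b = \<zero> \<longleftrightarrow> x \<oplus> b \<ominus> x = b"
      using A.inv_solve_right'[of \<zero> "x \<oplus> b \<ominus> x" b] A.l_one[of b] A.one_closed b d
      by (auto simp: add_commutator_def a_minus_def a_inv_def)
    also have "\<dots> \<longleftrightarrow> x \<oplus> b = b \<oplus> x"
      using A.inv_solve_right'[of b "x \<oplus> b" x] b x c
      by (auto simp: a_minus_def a_inv_def)
    finally show ?thesis by (simp add: zero_eq_one)
  qed
  show ?thesis using star comm x by (auto simp: brace_centralizer_def)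
qed

lemma brace_centralizer_subgroup:
  assumes x: "x \<in> carrier B"
  shows "subgroup (brace_centralizer B x) B"
proof -
  interpret A: group "add_monoid B" by (rule add_group)
  interpret C: group B by (rule circ_group)
  note iff = brace_centralizer_iff[OF x]
  have pc: "p \<oplus> q \<in> carrier B" "\<ominus> p \<in> carrier B"
    and pa: "p \<ominus> q \<oplus> q = p" "p \<oplus> q \<ominus> q = p"
    and pi: "p \<ominus> q \<in> carrier B"
    if "p \<in> carrier B" "q \<in> carrier B" for p q
    using that A.m_closed[of p q] A.inv_closed[of p] A.m_closed[of p "\<ominus> q"]
      A.inv_closed[of q] A.m_assoc[of p "\<ominus> q" q] A.m_assoc[of p q "\<ominus> q"]
      A.l_inv[of q] A.r_inv[of q] A.r_one[of p]
    by (simp_all add: a_minus_def a_inv_def)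
  have as: "p \<oplus> q \<oplus> r = p \<oplus> (q \<oplus> r)"
    if "p \<in> carrier B" "q \<in> carrier B" "r \<in> carrier B" for p q r
    using A.m_assoc[of p q r] that by simp
  have minus_plus: "p \<ominus> q \<oplus> (q \<oplus> r) = p \<oplus> r"
    if "p \<in> carrier B" "q \<in> carrier B" "r \<in> carrier B" for p q r
    using as[of "p \<ominus> q" q r] pa(1)[of p q] pi that by simp
  show ?thesis
  proof (rule C.subgroupI)
    show "brace_centralizer B x \<subseteq> carrier B" by (auto simp: brace_centralizer_def)
    have "\<one> \<in> brace_centralizer B x"
      using iff A.l_one[of x] A.r_one[of x] x zero_eq_one by simp
    thus "brace_centralizer B x \<noteq> {}" by blast
  next
    fix b assume b: "b \<in> brace_centralizer B x"
    define b' where "b' = m_inv B b"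
    from b iff have bB: "b \<in> carrier B" and 1: "x \<otimes> b = x \<oplus> b" "b \<otimes> x = b \<oplus> x" "x \<oplus> b = b \<oplus> x"
      by auto
    have b': "b' \<in> carrier B" "b \<otimes> b' = \<one>" "b' \<otimes> b = \<one>" using bB by (auto simp: b'_def)
    have z: "\<one> \<in> carrier B" "p \<oplus> \<one> = p" "\<one> \<oplus> p = p" if "p \<in> carrier B" for p
      using A.l_one[of p] A.r_one[of p] that zero_eq_one by auto
    have c1: "x \<otimes> b' = b' \<otimes> x"
      using 1 bB b' x C.m_assoc[of b' x b] C.m_assoc[of "b' \<otimes> x" b b'] C.m_assoc[of b' b x]
      by (metis C.inv_solve_left C.inv_solve_right C.m_closed C.m_assoc C.r_one C.l_one)
    have "b \<otimes> (x \<oplus> b') = (b \<otimes> x) \<ominus> b \<oplus> \<one>" using brace_law[OF bB x b'(1)] b' by simp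
    also have "\<dots> = x" using 1(2) 1(3)[symmetric] pa(2)[OF x bB] z x by simp
    finally have 2: "x \<oplus> b' = b' \<otimes> x"
      using b' bB x pc C.m_assoc[of b' b "x \<oplus> b'"] by simp
    have "b \<otimes> (b' \<oplus> x) = \<one> \<ominus> b \<oplus> (b \<oplus> x)" using brace_law[OF bB b'(1) x] b' 1 by simp
    also have "\<dots> = x" using minus_plus z x bB by simp
    finally have 3: "b' \<oplus> x = b' \<otimes> x"
      using b' bB x pc C.m_assoc[of b' b "b' \<oplus> x"] by simp
    show "m_inv B b \<in> brace_centralizer B x"
      using iff c1 2 3 b' by (simp add: b'_def)
  next
    fix b c assume b: "b \<in> brace_centralizer B x" and c: "c \<in> brace_centralizer B x"
    from b iff have bB: "b \<in> carrier B" and 1: "x \<otimes> b = x \<oplus> b" "b \<otimes> x = b \<oplus> x" "x \<oplus> b = b \<oplus> x"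
      by auto
    from c iff have cB: "c \<in> carrier B" and 2: "x \<otimes> c = x \<oplus> c" "c \<otimes> x = c \<oplus> x" "x \<oplus> c = c \<oplus> x"
      by auto
    have bc: "b \<otimes> c \<in> carrier B" using bB cB by simp
    have 3: "(b \<otimes> c) \<otimes> x = (b \<otimes> c) \<oplus> x"
      using C.m_assoc[OF bB cB x] 2 brace_law[OF bB cB x] 1 minus_plus[OF bc bB x] by simp
    have "x \<otimes> (b \<otimes> c) = b \<otimes> (x \<otimes> c)"
      using C.m_assoc[OF x bB cB] C.m_assoc[OF bB x cB] 1 by simp
    also have "\<dots> = x \<oplus> (b \<otimes> c)"
      using 2 1 brace_law[OF bB x cB] pa(2)[OF x bB] by (metis (no_types))
    finally have 4: "x \<otimes> (b \<otimes> c) = x \<oplus> (b \<otimes> c)" .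
    have "x \<otimes> (b \<otimes> c) = (b \<otimes> c) \<otimes> x"
      using C.m_assoc x bB cB 1 2 by metis
    thus "b \<otimes> c \<in> brace_centralizer B x" using iff bc 3 4 by simp
  qed
qed

end

end

theory Submission
  imports Defs
begin

text \<open>
  Write \<open>C x\<close> for the brace centralizer of \<open>x\<close>. The set of all \<open>x\<close> for which \<open>C x\<close> has index at
  most \<open>n\<close> is closed, and \<open>FCI B\<close> is the union of these sets over all \<open>n\<close>; it is therefore an
  \<open>F\<^sub>\<sigma>\<close> set, without any countability assumption on the topology.

  The index bound gives a closed set because it can be tested on finite sets: the index is at most
  \<open>n\<close> iff any \<open>n + 1\<close> elements include two distinct \<open>a\<close>, \<open>b\<close> in the same coset, that is, with
  \<open>a \<otimes> b\<^sup>-\<^sup>1 \<in> C x\<close> (\<open>finite_rcosets_iff\<close>). For a fixed element \<open>c\<close> the condition \<open>c \<in> C x\<close> is a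
  conjunction of equations between continuous functions of \<open>x\<close>, hence closed in a Hausdorff
  topology (\<open>closedin_centralized_by\<close>). The bound thus describes an intersection, over arbitrarily
  many finite sets, of finite unions of closed sets.
\<close>

text \<open>
  Pigeonhole, together with a choice of representatives for finitely many cosets. The right-hand
  side involves \<open>H\<close> only through membership of individual elements, so that \<open>H\<close> can vary with a
  parameter.
\<close>
lemma (in group) finite_rcosets_iff:
  assumes H: "subgroup H G"
  shows "finite (rcosets H) \<longleftrightarrow>
    (\<exists>n. \<forall>F. F \<subseteq> carrier G \<and> card F = Suc n \<longrightarrow>
      (\<exists>a\<in>F. \<exists>b\<in>F. a \<noteq> b \<and> a \<otimes> inv b \<in> H))"
    (is "_ \<longleftrightarrow> (\<exists>n. ?crowded n)")
proof -
  have same_coset: "H #> a = H #> b \<longleftrightarrow> a \<otimes> inv b \<in> H"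
    if "a \<in> carrier G" "b \<in> carrier G" for a b
  proof -
    have "H #> a = H #> b \<longleftrightarrow> a \<in> H #> b"
      using repr_independence[OF _ that(2) H] rcos_self[OF that(1) H] by blast
    also have "\<dots> \<longleftrightarrow> a \<otimes> inv b \<in> H"
      using subgroup.rcos_module[OF H is_group that(2,1)] .
    finally show ?thesis .
  qed
  have image: "rcosets H = (\<lambda>a. H #> a) ` carrier G"
    by (auto simp: RCOSETS_def)
  show ?thesis
  proof
    assume fin: "finite (rcosets H)"
    have "?crowded (card (rcosets H))"
    proof (intro allI impI)
      fix F assume F: "F \<subseteq> carrier G \<and> card F = Suc (card (rcosets H))"
      then have "(\<lambda>a. H #> a) ` F \<subseteq> rcosets H"
        using image by blast
      then have "\<not> inj_on (\<lambda>a. H #> a) F"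
        using card_inj_on_le[OF _ _ fin] F by fastforce
      then show "\<exists>a\<in>F. \<exists>b\<in>F. a \<noteq> b \<and> a \<otimes> inv b \<in> H"
        using F same_coset unfolding inj_on_def by (metis subsetD)
    qed
    then show "\<exists>n. ?crowded n" ..
  next
    assume "\<exists>n. ?crowded n"
    then obtain n where n: "?crowded n" ..
    show "finite (rcosets H)"
    proof (rule ccontr)
      assume "infinite (rcosets H)"
      then obtain K where K: "K \<subseteq> rcosets H" "card K = Suc n"
        using infinite_arbitrarily_large by blast
      then obtain F where F: "F \<subseteq> carrier G" "inj_on (\<lambda>a. H #> a) F" "K = (\<lambda>a. H #> a) ` F"
        unfolding image subset_image_inj by blast
      then have "card F = Suc n"
        using K(2) card_image by metis
      then obtain a b where "a \<in> F" "b \<in> F" "a \<noteq> b" "a \<otimes> inv b \<in> H"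
        using n F(1) by blast
      then show False
        using F(1,2) same_coset unfolding inj_on_def by (metis subsetD)
    qed
  qed
qed

lemma topological_group_translations_continuous:
  assumes G: "topological_group G T" and c: "c \<in> carrier G"
  shows "continuous_map T T (\<lambda>x. x \<otimes>\<^bsub>G\<^esub> c)" "continuous_map T T (\<lambda>x. c \<otimes>\<^bsub>G\<^esub> x)"
proof -
  have mult: "continuous_map (prod_topology T T) T (\<lambda>(x, y). x \<otimes>\<^bsub>G\<^esub> y)"
    and c: "c \<in> topspace T"
    using G c by (auto simp: topological_group_def)
  have "continuous_map T (prod_topology T T) (\<lambda>x. (x, c))"
    "continuous_map T (prod_topology T T) (\<lambda>x. (c, x))"
    using c by (auto intro!: continuous_map_pairedI)
  from this[THEN continuous_map_compose, OF mult]
  show "continuous_map T T (\<lambda>x. x \<otimes>\<^bsub>G\<^esub> c)" "continuous_map T T (\<lambda>x. c \<otimes>\<^bsub>G\<^esub> x)"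
    by (simp_all add: o_def)
qed

lemma closedin_in_borel_sets_of:
  assumes "closedin T S"
  shows "S \<in> borel_sets_of T"
proof -
  have "topspace T - (topspace T - S) \<in> borel_sets_of T"
    using assms unfolding borel_sets_of_def
    by (intro sigma_sets.Compl sigma_sets.Basic) auto
  then show ?thesis
    using closedin_subset[OF assms] by (simp add: double_diff)
qed

context Hausdorff_topological_skew_left_brace
begin

lemma topspace_eq_carrier: "topspace T = carrier B"
  using circ_topological_group by (simp add: topological_group_def)

text \<open>
  The brace centralizer itself is a set of \<open>c\<close> for given \<open>x\<close>; here the roles are exchanged. The
  equations defining it relate left and right translations by \<open>c\<close> in the two groups, and the
  coincidence set of two continuous maps into a Hausdorff space is closed.
\<close>
lemma closedin_centralized_by:
  assumes c: "c \<in> carrier B"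
  shows "closedin T {x \<in> carrier B. c \<in> brace_centralizer B x}"
proof -
  note circ = topological_group_translations_continuous[OF circ_topological_group c]
  have add: "continuous_map T T (\<lambda>x. x \<oplus> c)" "continuous_map T T (\<lambda>x. c \<oplus> x)"
    using topological_group_translations_continuous[OF add_topological_group, of c] c by simp_all
  note coincide = closedin_continuous_maps_eq[OF Hausdorff]
  have "{x \<in> carrier B. c \<in> brace_centralizer B x} =
      {x \<in> topspace T. x \<otimes> c = x \<oplus> c} \<inter> {x \<in> topspace T. c \<otimes> x = c \<oplus> x}
        \<inter> {x \<in> topspace T. x \<oplus> c = c \<oplus> x}"
    using c by (auto simp: brace_centralizer_iff topspace_eq_carrier)
  then show ?thesis
    using coincide[OF circ(1) add(1)] coincide[OF circ(2) add(2)] coincide[OF add]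
    by (simp add: closedin_Int)
qed

lemma closedin_bounded_index:
  "closedin T {x \<in> carrier B. \<forall>F. F \<subseteq> carrier B \<and> card F = Suc n \<longrightarrow>
     (\<exists>a\<in>F. \<exists>b\<in>F. a \<noteq> b \<and> a \<otimes> inv b \<in> brace_centralizer B x)}"
    (is "closedin T ?S")
proof -
  interpret C: group B by (rule circ_group)
  define P where "P F = (\<Union>(a, b) \<in> {(a, b) \<in> F \<times> F. a \<noteq> b}.
    {x \<in> carrier B. a \<otimes> inv b \<in> brace_centralizer B x})" for F
  define \<F> where "\<F> = {F. F \<subseteq> carrier B \<and> card F = Suc n}"
  have closed: "closedin T (P F)" if "F \<in> \<F>" for F
  proof -
    have F: "finite F" "F \<subseteq> carrier B"
      using that card_ge_0_finite[of F] by (auto simp: \<F>_def)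
    have "finite {(a, b) \<in> F \<times> F. a \<noteq> b}"
      by (rule finite_subset[of _ "F \<times> F"]) (use F(1) in auto)
    then show ?thesis
      unfolding P_def using F(2)
      by (intro closedin_Union) (auto intro!: closedin_centralized_by)
  qed
  \<comment> \<open>If \<open>B\<close> has at most \<open>n\<close> elements, then \<open>\<F>\<close> is empty; inserting the whole space keeps the
      intersection inside \<open>B\<close>.\<close>
  have S_eq: "?S = \<Inter>(insert (topspace T) (P ` \<F>))"
  proof -
    have "x \<in> P F \<longleftrightarrow> (\<exists>a\<in>F. \<exists>b\<in>F. a \<noteq> b \<and> a \<otimes> inv b \<in> brace_centralizer B x)"
      if "x \<in> carrier B" for x F
      using that by (auto simp: P_def)
    then show ?thesis
      by (auto simp: \<F>_def topspace_eq_carrier)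
  qed
  show ?thesis
    unfolding S_eq by (rule closedin_Inter) (use closed in auto)
qed

end

theorem proposition5p8:
  fixes B :: "('a, 'm) ring_scheme" and T :: "'a topology"
  assumes "Hausdorff_topological_skew_left_brace B T"
  shows "FCI B \<in> borel_sets_of T"
proof -
  interpret Hausdorff_topological_skew_left_brace B T by (rule assms)
  interpret C: group B by (rule circ_group)
  have "FCI B = (\<Union>n. {x \<in> carrier B. \<forall>F. F \<subseteq> carrier B \<and> card F = Suc n \<longrightarrow>
     (\<exists>a\<in>F. \<exists>b\<in>F. a \<noteq> b \<and> a \<otimes>\<^bsub>B\<^esub> inv\<^bsub>B\<^esub> b \<in> brace_centralizer B x)})"
    unfolding FCI_def UNION_eq
    by (simp add: C.finite_rcosets_iff[OF brace_centralizer_subgroup] cong: conj_cong)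
  then show ?thesis
    using closedin_in_borel_sets_of[OF closedin_bounded_index]
    unfolding borel_sets_of_def by (simp only: sigma_sets.Union)
qed

end
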